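(* Let $\mathcal{A}$ be a unital complex Banach algebra with identity $\mathbf{1}$, and let $\phi:\mathcal{A}\to\mathbb{C}$ be linear. Then $\phi$ is a character of $\mathcal{A}$ if and only if $\phi(\mathbf{1})=1$ and $\phi(a)\ne0$ for every invertible element $a\in\mathcal{A}$.
   Context: A unital complex Banach algebra is an associative (not necessarily commutative) complex algebra with a complete norm satisfying $\|xy\|\le\|x\|\|y\|$ and an identity $\mathbf{1}\ne0$ with $\|\mathbf{1}\|=1$. A character of $\mathcal{A}$ is a nonzero homomorphism $\mathcal{A}\to\mathbb{C}$, i.e. a nonzero linear map that is multiplicative. No continuity of $\phi$ is assumed. *)

theory Defs
  imports Complex_Main
begin

text \<open>
  Unital complex Banach algebras, obtained from the library classes of unital real normed algebras
  (\<^class>\<open>real_normed_algebra_1\<close>: associative, submultiplicative norm, \<open>1 \<noteq> 0\<close>, \<open>norm 1 = 1\<close>) and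
  complete normed spaces (\<^class>\<open>banach\<close>) by adding a complex scalar multiplication.
  The axiom \<open>scaleC_of_real\<close> ties the inherited real structure to the complex one: real scalar
  multiplication is the restriction of the complex one and carries no further information.
\<close>

class complex_banach_algebra_1 = real_normed_algebra_1 + banach +
  fixes scaleC :: "complex \<Rightarrow> 'a \<Rightarrow> 'a"  (infixr "*\<^sub>C" 75)
  assumes scaleC_add_right: "c *\<^sub>C (x + y) = c *\<^sub>C x + c *\<^sub>C y"
    and scaleC_add_left: "(c + d) *\<^sub>C x = c *\<^sub>C x + d *\<^sub>C x"
    and scaleC_scaleC: "c *\<^sub>C d *\<^sub>C x = (c * d) *\<^sub>C x"
    and scaleC_one: "1 *\<^sub>C x = x"
    and scaleC_of_real: "complex_of_real r *\<^sub>C x = r *\<^sub>R x"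
    and mult_scaleC_left: "(c *\<^sub>C x) * y = c *\<^sub>C (x * y)"
    and mult_scaleC_right: "x * (c *\<^sub>C y) = c *\<^sub>C (x * y)"
    and norm_scaleC: "norm (c *\<^sub>C x) = cmod c * norm x"

lemma vector_space_scaleC:
  "vector_space ((*\<^sub>C) :: complex \<Rightarrow> 'a \<Rightarrow> 'a::complex_banach_algebra_1)"
  by unfold_locales (simp_all add: scaleC_add_right scaleC_add_left scaleC_scaleC scaleC_one)

instantiation complex :: complex_banach_algebra_1
begin

definition scaleC_complex :: "complex \<Rightarrow> complex \<Rightarrow> complex"
  where "scaleC_complex c x = c * x"

instance
  by standard (simp_all add: scaleC_complex_def algebra_simps norm_mult scaleR_conv_of_real)

end

text \<open>Complex-linear functionals; no continuity is required.\<close>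

abbreviation clinear_functional :: "('a::complex_banach_algebra_1 \<Rightarrow> complex) \<Rightarrow> bool"
  where "clinear_functional \<phi> \<equiv> Vector_Spaces.linear (*\<^sub>C) (*) \<phi>"

definition character :: "('a::complex_banach_algebra_1 \<Rightarrow> complex) \<Rightarrow> bool"
  where "character \<phi> \<longleftrightarrow>
    clinear_functional \<phi> \<and> (\<forall>x y. \<phi> (x * y) = \<phi> x * \<phi> y) \<and> (\<exists>x. \<phi> x \<noteq> 0)"

text \<open>Two-sided invertibility: the algebra need not be commutative, so \<^const>\<open>dvd\<close> does not apply.\<close>

definition invertible_element :: "'a::monoid_mult \<Rightarrow> bool"
  where "invertible_element a \<longleftrightarrow> (\<exists>b. a * b = 1 \<and> b * a = 1)"

end

theory Submission
  imports Defs "HOL-Computational_Algebra.Fundamental_Theorem_Algebra"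
begin

text \<open>
  A character takes the value \<open>1\<close> at \<open>1\<close>, so it cannot vanish at an invertible element. The
  content is the converse, the Gleason--Kahane--Zelazko theorem. The proof below is the elementary
  one of Roitman and Sternfeld, in which the fundamental theorem of algebra and the Neumann series
  replace the theory of entire functions.

  Fix \<open>a\<close> and \<open>n\<close>, and let \<open>p(z) = \<phi> ((1 - z a)\<^sup>n) = \<Sum>\<^sub>k (n choose k) (-z)\<^sup>k \<phi>(a\<^sup>k)\<close>, a polynomial of
  degree at most \<open>n\<close> with \<open>p(0) = 1\<close>. Write it as \<open>\<Prod>\<^sub>i (1 - x\<^sub>i z)\<close> with at most \<open>n\<close> factors.
  If \<open>x\<^sub>i \<noteq> 0\<close>, then \<open>1/x\<^sub>i\<close> is a root of \<open>p\<close>, and the element \<open>1 - a/x\<^sub>i\<close> is not invertible, because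
  \<open>\<phi>\<close> vanishes at its \<open>n\<close>-th power. So \<open>\<bar>x\<^sub>i\<bar> \<le> \<parallel>a\<parallel>\<close> by the Neumann series. The coefficients of \<open>z\<close>
  and \<open>z\<^sup>2\<close> give
  \<open>\<Sum> x\<^sub>i = n \<phi>(a)\<close> and \<open>(\<Sum> x\<^sub>i)\<^sup>2 - \<Sum> x\<^sub>i\<^sup>2 = n(n-1) \<phi>(a\<^sup>2)\<close>. Hence
  \<open>\<bar>n\<^sup>2 \<phi>(a)\<^sup>2 - n(n-1) \<phi>(a\<^sup>2)\<bar> \<le> n \<parallel>a\<parallel>\<^sup>2\<close>, and since \<open>n\<close> is arbitrary, \<open>\<phi>(a\<^sup>2) = \<phi>(a)\<^sup>2\<close>
  (lemma \<open>square_preserving_if_nonzero_on_invertibles\<close>).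

  A purely algebraic argument then shows that a linear functional that preserves squares is
  multiplicative, even when the algebra is not commutative (lemma
  \<open>multiplicative_if_square_preserving\<close>).
\<close>

section \<open>Invertible elements and linear functionals\<close>

text \<open>The inverse is the Neumann series \<open>\<Sum>\<^sub>n x\<^sup>n\<close>.\<close>

lemma invertible_element_one_minus:
  fixes x :: "'a::{real_normed_algebra_1,banach}"
  assumes "norm x < 1"
  shows "invertible_element (1 - x)"
proof -
  let ?S = "\<Sum>n. x ^ n"
  have s: "summable (\<lambda>n. x ^ n)"
    using assms by (rule complete_algebra_summable_geometric)
  have tail: "(\<Sum>n. x ^ Suc n) = ?S - 1"
    using suminf_split_head[OF s] by simp
  have "x * ?S = ?S - 1"
    using suminf_mult[OF s, of x] tail by simp
  moreover have "?S * x = ?S - 1"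
    using suminf_mult2[OF s, of x] tail by (simp add: power_commutes)
  ultimately have "(1 - x) * ?S = 1 \<and> ?S * (1 - x) = 1"
    by (simp add: algebra_simps)
  then show ?thesis
    unfolding invertible_element_def by blast
qed

lemma invertible_element_power:
  "invertible_element a \<Longrightarrow> invertible_element (a ^ n)"
  unfolding invertible_element_def by (meson left_right_inverse_power)

text \<open>
  Interpreting the locale of linear maps in the proofs below would add \<open>a * (b * x) = (a * b) * x\<close>
  to the simpset, since multiplication is the scaling of \<open>\<complex>\<close> over itself, and this rule loops
  with associativity; hence this extract.
\<close>

lemma clinear_functional_simps:
  fixes \<phi> :: "'a::complex_banach_algebra_1 \<Rightarrow> complex"
  assumes "clinear_functional \<phi>"
  shows "\<phi> (x + y) = \<phi> x + \<phi> y" "\<phi> (x - y) = \<phi> x - \<phi> y" "\<phi> (c *\<^sub>C x) = c * \<phi> x"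
    "\<phi> (sum f A) = (\<Sum>i\<in>A. \<phi> (f i))"
proof -
  interpret \<phi>: Vector_Spaces.linear "(*\<^sub>C)" "(*)" \<phi>
    by (rule assms)
  show "\<phi> (x + y) = \<phi> x + \<phi> y" "\<phi> (x - y) = \<phi> x - \<phi> y" "\<phi> (c *\<^sub>C x) = c * \<phi> x"
    "\<phi> (sum f A) = (\<Sum>i\<in>A. \<phi> (f i))"
    by (rule \<phi>.add \<phi>.diff \<phi>.scale \<phi>.sum)+
qed

section \<open>Binomial expansion and factorisation of polynomials\<close>

text \<open>
  The expansion takes place in the algebra itself, which may be noncommutative; it holds there
  because \<open>1\<close> and the powers of \<open>x\<close> commute with one another.
\<close>

lemma one_plus_power_eq_sum_binomial:
  fixes x :: "'a::semiring_1"
  shows "(1 + x) ^ n = (\<Sum>k\<le>n. of_nat (n choose k) * x ^ k)"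
proof (induction n)
  case 0
  then show ?case by simp
next
  case (Suc n)
  let ?c = "\<lambda>k. of_nat (n choose k) * x ^ k"
  have "(1 + x) ^ Suc n = (\<Sum>k\<le>n. ?c k) + (\<Sum>k\<le>n. ?c k) * x"
    unfolding power_Suc2 Suc.IH by (simp add: distrib_left)
  also have "(\<Sum>k\<le>n. ?c k) * x = (\<Sum>k\<le>n. of_nat (n choose k) * x ^ Suc k)"
    unfolding sum_distrib_right by (simp add: mult.assoc power_commutes)
  also have "(\<Sum>k\<le>n. ?c k) = (\<Sum>k\<le>Suc n. ?c k)"
    by (simp add: binomial_eq_0)
  also have "\<dots> = 1 + (\<Sum>k\<le>n. ?c (Suc k))"
    by (subst sum.atMost_Suc_shift) simp
  also have "\<dots> + (\<Sum>k\<le>n. of_nat (n choose k) * x ^ Suc k)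
      = 1 + (\<Sum>k\<le>n. of_nat (Suc n choose Suc k) * x ^ Suc k)"
    by (simp add: sum.distrib distrib_right add_ac)
  also have "\<dots> = (\<Sum>k\<le>Suc n. of_nat (Suc n choose k) * x ^ k)"
    by (simp only: sum.atMost_Suc_shift) simp
  finally show ?case .
qed

text \<open>
  Splitting off factors \<open>1 - x z\<close> rather than \<open>z - r\<close> normalises at \<open>0\<close> instead of at the leading
  coefficient, so the exact degree does not have to be known.
\<close>

lemma complex_poly_factors_one_minus:
  fixes p :: "complex poly"
  assumes "poly p 0 = 1"
  shows "\<exists>xs. p = (\<Prod>x\<leftarrow>xs. [:1, - x:]) \<and> length xs = degree p"
  using assms
proof (induction "degree p" arbitrary: p)
  case 0
  then obtain c where "p = [:c:]"
    by (metis degree_eq_zeroE)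
  with 0 show ?case
    by (intro exI[of _ "[]"]) (simp add: one_pCons)
next
  case (Suc d)
  have "\<not> constant (poly p)"
    using Suc.hyps(2) by (simp add: constant_degree)
  then obtain r where r: "poly p r = 0"
    using fundamental_theorem_of_algebra by blast
  then have r0: "r \<noteq> 0"
    using Suc.prems by auto
  from r obtain q where q: "p = [:- r, 1:] * q"
    by (auto simp: poly_eq_0_iff_dvd)
  define q' where "q' = smult (- r) q"
  have p: "p = [:1, - (1 / r):] * q'"
  proof -
    have "[:- r, 1:] = smult (- r) [:1, - (1 / r):]"
      using r0 by simp
    then show ?thesis
      unfolding q q'_def by (metis mult_smult_left mult_smult_right)
  qed
  have "q' \<noteq> 0"
    using p Suc.prems by auto
  then have "degree p = Suc (degree q')"
    unfolding p using r0 by (subst degree_mult_eq) auto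
  moreover have "poly q' 0 = 1"
    using Suc.prems unfolding p by simp
  ultimately obtain xs where "q' = (\<Prod>x\<leftarrow>xs. [:1, - x:])" "length xs = degree q'"
    using Suc.hyps by (metis nat.inject)
  then show ?case
    using p \<open>degree p = Suc (degree q')\<close> by (intro exI[of _ "1 / r # xs"]) simp
qed

text \<open>
  The case \<open>k = 2\<close> of Newton's identities: the second coefficient is the elementary symmetric
  function \<open>e\<^sub>2\<close>, and \<open>2 e\<^sub>2 = e\<^sub>1\<^sup>2 - \<Sum> x\<^sup>2\<close>.
\<close>

lemma coeff_prod_one_minus:
  fixes xs :: "'a::comm_ring_1 list"
  defines "P \<equiv> (\<Prod>x\<leftarrow>xs. [:1, - x:])"
  shows "coeff P 0 = 1" "coeff P 1 = - sum_list xs"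
    "2 * coeff P 2 = (sum_list xs)\<^sup>2 - (\<Sum>x\<leftarrow>xs. x\<^sup>2)"
proof -
  have "coeff P 0 = 1 \<and> coeff P 1 = - sum_list xs \<and>
      2 * coeff P 2 = (sum_list xs)\<^sup>2 - (\<Sum>x\<leftarrow>xs. x\<^sup>2)"
    unfolding P_def
    by (induction xs) (auto simp: coeff_pCons numeral_2_eq_2 power2_eq_square algebra_simps)
  then show "coeff P 0 = 1" "coeff P 1 = - sum_list xs"
    "2 * coeff P 2 = (sum_list xs)\<^sup>2 - (\<Sum>x\<leftarrow>xs. x\<^sup>2)"
    by auto
qed

section \<open>Functionals without zeros among the invertible elements\<close>

text \<open>
  The roots of the polynomial \<open>p(z) = \<phi> ((1 - z a)\<^sup>n)\<close> stay away from \<open>0\<close> uniformly in \<open>n\<close>. So the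
  power sum \<open>\<Sum> x\<^sub>i\<^sup>2\<close> of their reciprocals grows only linearly in \<open>n\<close>, whereas by Newton's identity
  it equals \<open>n\<^sup>2 (\<phi>(a)\<^sup>2 - \<phi>(a\<^sup>2)) + n \<phi>(a\<^sup>2)\<close>.
\<close>

lemma square_preserving_if_nonzero_on_invertibles:
  fixes \<phi> :: "'a::complex_banach_algebra_1 \<Rightarrow> complex"
  assumes lin: "clinear_functional \<phi>" and one: "\<phi> 1 = 1"
    and inv: "\<And>a. invertible_element a \<Longrightarrow> \<phi> a \<noteq> 0"
  shows "\<phi> (a * a) = \<phi> a * \<phi> a"
proof -
  note \<phi>_simps = clinear_functional_simps[OF lin]
  have of_nat: "of_nat m * x = of_nat m *\<^sub>C x" for m and x :: 'a
    by (metis of_real_of_nat_eq scaleC_of_real scaleR_conv_of_real)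
  have power: "(c *\<^sub>C x) ^ k = c ^ k *\<^sub>C x ^ k" for c k and x :: 'a
    by (induction k)
      (simp_all add: scaleC_one mult_scaleC_left mult_scaleC_right scaleC_scaleC mult.commute)
  have bound: "cmod ((of_nat n)\<^sup>2 * (\<phi> a)\<^sup>2 - of_nat n * (of_nat n - 1) * \<phi> (a * a))
      \<le> of_nat n * (norm a)\<^sup>2" for n
  proof -
    define p where "p = (\<Sum>k\<le>n. monom (of_nat (n choose k) * ((- 1) ^ k * \<phi> (a ^ k))) k)"
    have coeff: "coeff p k = of_nat (n choose k) * ((- 1) ^ k * \<phi> (a ^ k))" for k
      unfolding p_def coeff_sum coeff_monom by (auto simp: binomial_eq_0)
    have poly: "poly p z = \<phi> ((1 + (- z) *\<^sub>C a) ^ n)" for z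
    proof -
      have "\<phi> ((1 + (- z) *\<^sub>C a) ^ n) = (\<Sum>k\<le>n. of_nat (n choose k) * ((- z) ^ k * \<phi> (a ^ k)))"
        unfolding one_plus_power_eq_sum_binomial of_nat power \<phi>_simps ..
      also have "\<dots> = (\<Sum>k\<le>n. of_nat (n choose k) * ((- 1) ^ k * \<phi> (a ^ k)) * z ^ k)"
        by (intro sum.cong refl) (subst power_minus, simp only: ac_simps)
      also have "\<dots> = poly p z"
        unfolding p_def by (simp only: poly_sum poly_monom)
      finally show ?thesis ..
    qed
    have "poly p 0 = 1"
      using coeff[of 0] by (simp add: poly_0_coeff_0 one)
    then obtain xs where p: "p = (\<Prod>x\<leftarrow>xs. [:1, - x:])" and len: "length xs = degree p"
      using complex_poly_factors_one_minus by blast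
    have "degree p \<le> n"
      by (rule degree_le) (simp add: coeff binomial_eq_0)
    \<comment> \<open>Otherwise \<open>a / x\<close> has norm below \<open>1\<close>, although \<open>\<phi>\<close> vanishes at \<open>(1 - a / x)\<^sup>n\<close>.\<close>
    have norm_le: "cmod x \<le> norm a" if "x \<in> set xs" for x
    proof (rule ccontr)
      assume "\<not> cmod x \<le> norm a"
      then have x: "norm a < cmod x" "x \<noteq> 0"
        by auto
      then have "norm ((1 / x) *\<^sub>C a) < 1"
        by (simp add: norm_scaleC norm_divide)
      then have "invertible_element ((1 - (1 / x) *\<^sub>C a) ^ n)"
        by (intro invertible_element_power invertible_element_one_minus)
      moreover have "1 + (- (1 / x)) *\<^sub>C a = 1 - (1 / x) *\<^sub>C a"
        using module.scale_minus_left[OF vector_space_scaleC[folded module_iff_vector_space], of "1 / x" a]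
        by simp
      ultimately have "poly p (1 / x) \<noteq> 0"
        unfolding poly using inv by simp
      moreover have "poly p (1 / x) = 0"
        unfolding p using \<open>x \<in> set xs\<close> \<open>x \<noteq> 0\<close>
        by (induction xs) auto
      ultimately show False by simp
    qed
    have choose2: "2 * of_nat (n choose 2) = (of_nat n * (of_nat n - 1) :: complex)"
    proof -
      have "2 * (n choose 2) = n * (n - 1)"
        by (cases n) (simp_all add: choose_two)
      then have "2 * of_nat (n choose 2) = (of_nat (n * (n - 1)) :: complex)"
        by (metis of_nat_mult of_nat_numeral)
      then show ?thesis
        by (cases n) (simp_all add: algebra_simps)
    qed
    have "sum_list xs = of_nat n * \<phi> a"
      using coeff[of 1] coeff_prod_one_minus(2)[of xs, folded p] by simp
    moreover have "2 * coeff p 2 = of_nat n * (of_nat n - 1) * \<phi> (a * a)"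
      unfolding coeff mult.assoc[symmetric] choose2 by (simp add: power2_eq_square)
    ultimately have "(of_nat n)\<^sup>2 * (\<phi> a)\<^sup>2 - of_nat n * (of_nat n - 1) * \<phi> (a * a)
        = (\<Sum>x\<leftarrow>xs. x\<^sup>2)"
      using coeff_prod_one_minus(3)[of xs, folded p]
      by (simp add: power_mult_distrib algebra_simps)
    also have "cmod \<dots> \<le> of_nat (length xs) * (norm a)\<^sup>2"
      using norm_le
    proof (induction xs)
      case (Cons x xs)
      have "cmod (x\<^sup>2) \<le> (norm a)\<^sup>2"
        using Cons.prems by (simp add: norm_power power_mono)
      then show ?case
        using Cons norm_triangle_ineq[of "x\<^sup>2" "\<Sum>x\<leftarrow>xs. x\<^sup>2"] by (simp add: algebra_simps)
    qed simp
    also have "\<dots> \<le> of_nat n * (norm a)\<^sup>2"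
      using len \<open>degree p \<le> n\<close> by (simp add: mult_right_mono)
    finally show ?thesis .
  qed
  \<comment> \<open>Dividing by \<open>n\<close> leaves a bound that does not depend on \<open>n\<close>, which forces \<open>?D = 0\<close>.\<close>
  let ?D = "(\<phi> a)\<^sup>2 - \<phi> (a * a)"
  have "of_nat n * cmod ?D \<le> (norm a)\<^sup>2 + cmod (\<phi> (a * a))" if "n > 0" for n
  proof -
    have "(of_nat n)\<^sup>2 * (\<phi> a)\<^sup>2 - of_nat n * (of_nat n - 1) * \<phi> (a * a)
        = of_nat n * (of_nat n * ?D + \<phi> (a * a))"
      by (simp add: algebra_simps power2_eq_square)
    then have "cmod (of_nat n * ?D + \<phi> (a * a)) \<le> (norm a)\<^sup>2"
      using bound[of n] that by (simp add: norm_mult)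
    then show ?thesis
      using norm_triangle_ineq4[of "of_nat n * ?D + \<phi> (a * a)" "\<phi> (a * a)"]
      by (simp add: norm_mult)
  qed
  then have "\<not> cmod ?D > 0"
    by (metis ex_less_of_nat_mult gr0I linorder_not_le mult_zero_left of_nat_0 add_nonneg_nonneg
        norm_ge_zero zero_le_power2)
  then show ?thesis
    by (simp add: power2_eq_square)
qed

section \<open>From squares to products\<close>

text \<open>
  Polarisation only gives \<open>\<phi> (x y + y x) = 2 \<phi>(x) \<phi>(y)\<close>. If \<open>\<phi>(x) = 0\<close>, then \<open>\<phi>\<close> kills every
  anticommutator with \<open>x\<close>, in particular \<open>x y + y x\<close> (hence its square) and \<open>x (y x y) + (y x y) x\<close>.
  The identity \<open>(x y - y x)\<^sup>2 + (x y + y x)\<^sup>2 = 2 (x (y x y) + (y x y) x)\<close> then kills the square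
  of the commutator, so the commutator too, and with it \<open>x y\<close>. The general case follows by
  replacing \<open>x\<close> with \<open>x - \<phi>(x) 1\<close>.
\<close>

lemma multiplicative_if_square_preserving:
  fixes \<phi> :: "'a::complex_banach_algebra_1 \<Rightarrow> complex"
  assumes lin: "clinear_functional \<phi>" and one: "\<phi> 1 = 1"
    and sq: "\<And>a. \<phi> (a * a) = \<phi> a * \<phi> a"
  shows "\<phi> (x * y) = \<phi> x * \<phi> y"
proof -
  note \<phi>_simps = clinear_functional_simps[OF lin]
  have anticomm: "\<phi> (x * y + y * x) = 2 * \<phi> x * \<phi> y" for x y
  proof -
    have "\<phi> (x * x) + \<phi> (x * y + y * x) + \<phi> (y * y) = \<phi> ((x + y) * (x + y))"
      unfolding \<phi>_simps(1)[symmetric] by (simp add: algebra_simps)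
    also have "\<dots> = (\<phi> x + \<phi> y) * (\<phi> x + \<phi> y)"
      unfolding sq \<phi>_simps ..
    finally show ?thesis
      unfolding sq by (simp add: algebra_simps)
  qed
  have kernel: "\<phi> (x * y) = 0" if x: "\<phi> x = 0" for x y
  proof -
    let ?c = "x * y - y * x" and ?s = "x * y + y * x" and ?t = "x * (y * x * y) + (y * x * y) * x"
    have s: "\<phi> ?s = 0" and "\<phi> ?t = 0"
      using anticomm x by simp_all
    moreover have "?c * ?c + ?s * ?s = ?t + ?t"
      by (simp add: algebra_simps)
    ultimately have "\<phi> ?c * \<phi> ?c = 0"
      by (metis \<phi>_simps(1) sq add_0_right mult_zero_left)
    then have "\<phi> (x * y) = \<phi> (y * x)"
      by (simp add: \<phi>_simps)
    with s show ?thesis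
      by (simp add: \<phi>_simps)
  qed
  have "\<phi> ((x - \<phi> x *\<^sub>C 1) * y) = 0"
    by (rule kernel) (simp add: \<phi>_simps one)
  then show ?thesis
    by (simp add: left_diff_distrib mult_scaleC_left \<phi>_simps)
qed

section \<open>The Gleason--Kahane--Zelazko theorem\<close>

theorem theorem2p62:
  fixes \<phi> :: "'a::complex_banach_algebra_1 \<Rightarrow> complex"
  assumes "clinear_functional \<phi>"
  shows "character \<phi> \<longleftrightarrow> \<phi> 1 = 1 \<and> (\<forall>a. invertible_element a \<longrightarrow> \<phi> a \<noteq> 0)"
proof
  assume "character \<phi>"
  then obtain x where mult: "\<And>x y. \<phi> (x * y) = \<phi> x * \<phi> y" and x: "\<phi> x \<noteq> 0"
    unfolding character_def by blast
  have one: "\<phi> 1 = 1"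
    using mult[of x 1] x by simp
  moreover have "\<phi> a \<noteq> 0" if "invertible_element a" for a
    using that mult one unfolding invertible_element_def by (metis mult_zero_left zero_neq_one)
  ultimately show "\<phi> 1 = 1 \<and> (\<forall>a. invertible_element a \<longrightarrow> \<phi> a \<noteq> 0)"
    by blast
next
  assume *: "\<phi> 1 = 1 \<and> (\<forall>a. invertible_element a \<longrightarrow> \<phi> a \<noteq> 0)"
  then have "\<phi> (a * a) = \<phi> a * \<phi> a" for a
    using square_preserving_if_nonzero_on_invertibles[OF assms] by blast
  then have "\<phi> (x * y) = \<phi> x * \<phi> y" for x y
    using multiplicative_if_square_preserving[OF assms] * by blast
  then show "character \<phi>"
    unfolding character_def using assms * by (metis zero_neq_one)
qed

end
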